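(* Let $G$ be a group and let $H$ be a finitely generated subgroup of $G$. If the emptiness problem for $G$-automata is decidable, then the subgroup membership problem for $H$ in $G$ is decidable.
   Context: A $G$-automaton is a 6-tuple $V=(Q,\Sigma,G,\delta,q_0,Q_a)$ where $Q$ is a finite set of states, $\Sigma$ is a finite input alphabet, $q_0\in Q$ is the initial state, $Q_a\subseteq Q$ is the set of accepting states, and $\delta$ assigns to each pair in $Q\times(\Sigma\cup\{\varepsilon\})$ ($\varepsilon$ the empty string) a finite subset of $Q\times G$. If $(q',m)\in\delta(q,\sigma)$, then in state $q$, reading $\sigma$ (consuming no input if $\sigma=\varepsilon$), $V$ may move to state $q'$ and replace its register content $x\in G$ by $xm$. The register initially contains the identity element $1$ of $G$. A string $w\in\Sigma^*$ is accepted if some computation starting in $q_0$ reads all of $w$ and ends in a state of $Q_a$ with register content equal to $1$. $L(V)\subseteq\Sigma^*$ denotes the set of accepted strings. The emptiness problem for $G$-automata: given a $G$-automaton $V$, decide whether $L(V)=\emptyset$, i.e. whether $V$ accepts no string. The subgroup membership problem for $H$ in $G$: given an element $g\in G$, decide whether $g\in H$, where $H$ is the subgroup of $G$ generated by given elements $h_1,\dots,h_n\in G$. Elements of $G$ occurring in inputs (as transition labels of automata, or as the element $g$) are given in one fixed encoding of the elements of $G$ by finite strings (for example, as words over a finite generating set and its inverses when $G$ is finitely generated), where every element of $G$ has at least one code. *)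

theory Defs
  imports "HOL-Algebra.Generated_Groups" "HOL-Library.Nat_Bijection"
begin

section \<open>Partial recursive functions and decision problems\<close>

datatype recf = Zero | Succ | Proj nat | Comp recf "recf list" | PrimRec recf recf | Mu recf

text \<open>\<open>None\<close> means that the value is undefined (divergence or wrong number of arguments).
  In \<open>PrimRec f g\<close> the recursion argument comes first; the step function \<open>g\<close> receives the
  predecessor, the previous value and the parameters. \<open>Mu f\<close> searches over the first
  argument of \<open>f\<close>, and \<open>f\<close> has to be defined at every smaller candidate.\<close>

fun rec_eval :: "recf \<Rightarrow> nat list \<Rightarrow> nat option" where
  "rec_eval Zero xs = Some 0"
| "rec_eval Succ xs = (case xs of [x] \<Rightarrow> Some (Suc x) | _ \<Rightarrow> None)"
| "rec_eval (Proj i) xs = (if i < length xs then Some (xs ! i) else None)"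
| "rec_eval (Comp f gs) xs =
     (case those (map (\<lambda>g. rec_eval g xs) gs) of None \<Rightarrow> None | Some ys \<Rightarrow> rec_eval f ys)"
| "rec_eval (PrimRec f g) xs =
     (case xs of [] \<Rightarrow> None
      | n # ps \<Rightarrow> rec_nat (rec_eval f ps)
          (\<lambda>i r. case r of None \<Rightarrow> None | Some y \<Rightarrow> rec_eval g (i # y # ps)) n)"
| "rec_eval (Mu f) xs =
     (if \<exists>n. rec_eval f (n # xs) = Some 0 \<and> (\<forall>m<n. \<exists>y. rec_eval f (m # xs) = Some (Suc y))
      then Some (LEAST n. rec_eval f (n # xs) = Some 0) else None)"

text \<open>A decision problem is given by a set \<open>I\<close> of instances, a Goedel numbering \<open>code\<close> of them and
  the property \<open>P\<close> to be decided. The algorithm must halt with the correct answer on every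
  instance; nothing is required on numbers that do not code an instance.\<close>

definition decidable_problem :: "('i \<Rightarrow> nat) \<Rightarrow> 'i set \<Rightarrow> ('i \<Rightarrow> bool) \<Rightarrow> bool" where
  "decidable_problem code I P \<longleftrightarrow>
     (\<exists>f. \<forall>i\<in>I. rec_eval f [code i] = Some (if P i then 1 else 0))"

section \<open>Automata over a group\<close>

text \<open>In \<open>trans\<close>, the symbol \<open>None\<close> stands for the empty string.\<close>

record ('q, 'a, 'g) g_automaton =
  states :: "'q set"
  alphabet :: "'a set"
  trans :: "'q \<Rightarrow> 'a option \<Rightarrow> ('q \<times> 'g) set"
  init :: 'q
  accepting :: "'q set"

definition is_g_automaton :: "('g, 'b) monoid_scheme \<Rightarrow> ('q, 'a, 'g) g_automaton \<Rightarrow> bool" where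
  "is_g_automaton G V \<longleftrightarrow>
     finite (states V) \<and> finite (alphabet V) \<and>
     init V \<in> states V \<and> accepting V \<subseteq> states V \<and>
     (\<forall>q\<in>states V. \<forall>s\<in>insert None (Some ` alphabet V).
        finite (trans V q s) \<and> trans V q s \<subseteq> states V \<times> carrier G)"

text \<open>\<open>run G V q x w q' x'\<close>: starting in state \<open>q\<close> with register content \<open>x\<close>, some computation
  reads exactly \<open>w\<close> and ends in state \<open>q'\<close> with register content \<open>x'\<close>.\<close>

inductive run ::
  "('g, 'b) monoid_scheme \<Rightarrow> ('q, 'a, 'g) g_automaton \<Rightarrow>
   'q \<Rightarrow> 'g \<Rightarrow> 'a list \<Rightarrow> 'q \<Rightarrow> 'g \<Rightarrow> bool"
  for G V where
  stop: "run G V q x [] q x"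
| eps: "(q', m) \<in> trans V q None \<Longrightarrow> run G V q' (x \<otimes>\<^bsub>G\<^esub> m) w r y \<Longrightarrow> run G V q x w r y"
| read: "(q', m) \<in> trans V q (Some a) \<Longrightarrow> run G V q' (x \<otimes>\<^bsub>G\<^esub> m) w r y \<Longrightarrow> run G V q x (a # w) r y"

definition language :: "('g, 'b) monoid_scheme \<Rightarrow> ('q, 'a, 'g) g_automaton \<Rightarrow> 'a list set" where
  "language G V =
     {w \<in> lists (alphabet V). \<exists>q\<in>accepting V. run G V (init V) \<one>\<^bsub>G\<^esub> w q \<one>\<^bsub>G\<^esub>}"

section \<open>Encodings\<close>

text \<open>An encoding of \<open>G\<close> by strings over a finite alphabet is given by its partial decoding
  function. An element may have several codes, and no effectiveness is assumed.\<close>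

definition group_encoding :: "('g, 'b) monoid_scheme \<Rightarrow> (nat list \<Rightarrow> 'g option) \<Rightarrow> bool" where
  "group_encoding G dec \<longleftrightarrow>
     (\<exists>A. finite A \<and> dom dec \<subseteq> lists A) \<and> ran dec = carrier G"

text \<open>A description lists the states, the input symbols, the transitions \<open>(q, s, q', u)\<close> where
  \<open>u\<close> is a code of the group element, the initial state and the accepting states.\<close>

type_synonym transition_desc = "nat \<times> nat option \<times> nat \<times> nat list"
type_synonym automaton_desc =
  "nat list \<times> nat list \<times> transition_desc list \<times> nat \<times> nat list"

fun automaton_of :: "(nat list \<Rightarrow> 'g option) \<Rightarrow> automaton_desc \<Rightarrow> (nat, nat, 'g) g_automaton" where
  "automaton_of dec (Qs, As, ts, q0, Fs) =
     \<lparr>states = set Qs, alphabet = set As,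
      trans = (\<lambda>q s. {(q', m). \<exists>u. (q, s, q', u) \<in> set ts \<and> dec u = Some m}),
      init = q0, accepting = set Fs\<rparr>"

fun valid_desc :: "('g, 'b) monoid_scheme \<Rightarrow> (nat list \<Rightarrow> 'g option) \<Rightarrow> automaton_desc \<Rightarrow> bool" where
  "valid_desc G dec (Qs, As, ts, q0, Fs) \<longleftrightarrow>
     is_g_automaton G (automaton_of dec (Qs, As, ts, q0, Fs)) \<and>
     (\<forall>(q, s, q', u)\<in>set ts. q \<in> set Qs \<and> s \<in> insert None (Some ` set As) \<and> u \<in> dom dec)"

fun transition_code :: "transition_desc \<Rightarrow> nat" where
  "transition_code (q, s, q', u) =
     prod_encode (q, prod_encode (case s of None \<Rightarrow> 0 | Some a \<Rightarrow> Suc a,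
       prod_encode (q', list_encode u)))"

fun desc_code :: "automaton_desc \<Rightarrow> nat" where
  "desc_code (Qs, As, ts, q0, Fs) =
     prod_encode (list_encode Qs, prod_encode (list_encode As,
       prod_encode (list_encode (map transition_code ts),
         prod_encode (q0, list_encode Fs))))"

lemma inj_transition_code: "inj transition_code"
proof (rule injI)
  fix x y assume "transition_code x = transition_code y"
  then show "x = y"
    by (cases x; cases y) (auto simp: inj_list_encode[THEN inj_eq] split: option.splits)
qed

lemma inj_desc_code: "inj desc_code"
proof (rule injI)
  fix x y assume "desc_code x = desc_code y"
  then show "x = y"
    by (cases x; cases y)
      (auto simp: inj_list_encode[THEN inj_eq] inj_transition_code inj_map_eq_map)
qed

section \<open>The two problems\<close>

definition emptiness_decidable :: "('g, 'b) monoid_scheme \<Rightarrow> (nat list \<Rightarrow> 'g option) \<Rightarrow> bool" where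
  "emptiness_decidable G dec \<longleftrightarrow>
     decidable_problem desc_code {d. valid_desc G dec d}
       (\<lambda>d. language G (automaton_of dec d) = {})"

definition membership_decidable ::
  "('g, 'b) monoid_scheme \<Rightarrow> (nat list \<Rightarrow> 'g option) \<Rightarrow> 'g set \<Rightarrow> bool" where
  "membership_decidable G dec H \<longleftrightarrow>
     decidable_problem list_encode (dom dec) (\<lambda>u. the (dec u) \<in> H)"

definition finitely_generated :: "('g, 'b) monoid_scheme \<Rightarrow> 'g set \<Rightarrow> bool" where
  "finitely_generated G H \<longleftrightarrow> (\<exists>S. finite S \<and> S \<subseteq> carrier G \<and> H = generate G S)"

end

theory Submission
  imports Defs
begin

text \<open>Let \<open>S\<close> generate \<open>H\<close>. Given a code of \<open>g\<close>, take the automaton that first multiplies its register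
  by \<open>g\<close> and then, in its accepting state, multiplies it any number of times by elements of \<open>S\<close> and
  their inverses, without reading any input. It accepts the empty word iff \<open>g\<^sup>-\<^sup>1 \<in> H\<close>, i.e. iff
  \<open>g \<in> H\<close>, and no other word. Codes of the finitely many loop labels are hard-wired, so that the code of
  the automaton is obtained from the code of \<open>g\<close> by finitely many pairings with constants.\<close>

definition computable :: "(nat \<Rightarrow> nat) \<Rightarrow> bool" where
  "computable h \<longleftrightarrow> (\<exists>f. \<forall>n. rec_eval f [n] = Some (h n))"

lemma computable_id: "computable (\<lambda>n. n)"
  unfolding computable_def by (rule exI[of _ "Proj 0"]) simp

lemma computable_Suc:
  assumes "computable h"
  shows "computable (\<lambda>n. Suc (h n))"
proof -
  obtain f where "\<And>n. rec_eval f [n] = Some (h n)"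
    using assms by (auto simp: computable_def)
  then show ?thesis
    unfolding computable_def by (intro exI[of _ "Comp Succ [f]"]) simp
qed

lemma computable_const: "computable (\<lambda>n. c)"
proof (induction c)
  case 0
  show ?case
    unfolding computable_def by (rule exI[of _ Zero]) simp
qed (rule computable_Suc)

definition rec_add :: recf where
  "rec_add = PrimRec (Proj 0) (Comp Succ [Proj 1])"

lemma rec_eval_rec_add: "rec_eval rec_add [m, n] = Some (m + n)"
  by (induction m) (simp_all add: rec_add_def)

definition rec_triangle :: recf where
  "rec_triangle = PrimRec Zero (Comp Succ [Comp rec_add [Proj 0, Proj 1]])"

lemma rec_eval_rec_triangle: "rec_eval rec_triangle [n] = Some (triangle n)"
  by (induction n) (simp_all add: rec_triangle_def rec_eval_rec_add)

lemma computable_prod_encode: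
  assumes "computable h" "computable k"
  shows "computable (\<lambda>n. prod_encode (h n, k n))"
proof -
  obtain f g where "\<And>n. rec_eval f [n] = Some (h n)" "\<And>n. rec_eval g [n] = Some (k n)"
    using assms by (auto simp: computable_def)
  then show ?thesis
    unfolding computable_def
    \<comment> \<open>The term mirrors
      \<open>prod_encode (a, b) = triangle (a + b) + a\<close>.\<close>
    by (intro exI[of _ "Comp rec_add [Comp rec_triangle [Comp rec_add [f, g]], f]"])
      (simp add: rec_eval_rec_add rec_eval_rec_triangle prod_encode_def)
qed

text \<open>Bridges the gap between emptiness, which is assumed decidable, and nonemptiness, to
  which membership is reduced.\<close>

lemma decidable_problem_not:
  assumes "decidable_problem code I P"
  shows "decidable_problem code I (\<lambda>i. \<not> P i)"
proof -
  obtain f where "\<And>i. i \<in> I \<Longrightarrow> rec_eval f [code i] = Some (if P i then 1 else 0)"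
    using assms by (auto simp: decidable_problem_def)
  then show ?thesis
    unfolding decidable_problem_def
    \<comment> \<open>Primitive recursion without parameters: 1 at 0, and 0 at every
      successor.\<close>
    by (intro exI[of _ "Comp (PrimRec (Comp Succ [Zero]) Zero) [f]"]) simp
qed

text \<open>Many-one reduction: compose the decision function with \<open>h\<close>. Computability
  is asked only of the map \<open>h\<close> on codes.\<close>

lemma decidable_problem_reduction:
  assumes "decidable_problem code I P" "computable h"
    and "\<And>j. j \<in> J \<Longrightarrow> r j \<in> I \<and> code (r j) = h (code' j) \<and> (P (r j) \<longleftrightarrow> Q j)"
  shows "decidable_problem code' J Q"
proof -
  obtain f where f: "\<And>i. i \<in> I \<Longrightarrow> rec_eval f [code i] = Some (if P i then 1 else 0)"
    using assms(1) by (auto simp: decidable_problem_def)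
  obtain g where g: "\<And>n. rec_eval g [n] = Some (h n)"
    using assms(2) by (auto simp: computable_def)
  have "rec_eval (Comp f [g]) [code' j] = Some (if Q j then 1 else 0)" if "j \<in> J" for j
    using assms(3)[OF that] f[of "r j"] g by simp
  then show ?thesis
    unfolding decidable_problem_def by blast
qed

lemma run_append:
  assumes "run G V q x w r y" "run G V r y w' s z"
  shows "run G V q x (w @ w') s z"
  using assms by induction (auto intro: run.intros)

definition membership_desc :: "nat list list \<Rightarrow> nat list \<Rightarrow> automaton_desc" where
  "membership_desc cs u =
     ([0, 1], [], (0, None, 1, u) # map (\<lambda>c. (1, None, 1, c)) cs, 0, [1])"

lemma membership_desc_valid:
  assumes "ran dec = carrier G" "set cs \<subseteq> dom dec" "u \<in> dom dec"
  shows "valid_desc G dec (membership_desc cs u)"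
proof -
  \<comment> \<open>As \<open>dec\<close> is a function, each entry of \<open>ts\<close> contributes
    at most one pair.\<close>
  have *: "finite {(q', m). \<exists>u. (q, s, q', u) \<in> set ts \<and> dec u = Some m}"
    for q :: nat and s :: "nat option" and ts :: "transition_desc list"
    by (rule finite_subset[of _ "(\<lambda>(_, _, q', u). (q', the (dec u))) ` set ts"]) (force, simp)
  show ?thesis
    unfolding membership_desc_def valid_desc.simps is_g_automaton_def automaton_of.simps
      g_automaton.select_convs
    using assms by (intro conjI ballI *) (auto intro: ranI)
qed

lemma computable_membership_desc_code:
  "\<exists>h. computable h \<and> (\<forall>u. desc_code (membership_desc cs u) = h (list_encode u))"
  unfolding membership_desc_def desc_code.simps list.map transition_code.simps list_encode.simps
  \<comment> \<open>Unifying with \<open>refl\<close> first reads \<open>h\<close> off the unfolded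
    code, where \<open>u\<close> occurs only inside \<open>list_encode u\<close>; the loop part is a
    constant. Computability then follows the shape of \<open>h\<close>.\<close>
  by (rule exI, rule conjI[rotated], rule allI, rule refl)
    (intro computable_prod_encode computable_const computable_Suc computable_id)

lemma membership_desc_language:
  assumes "group G" "S \<subseteq> carrier G"
    and cs: "set cs \<subseteq> dom dec" "(\<lambda>c. the (dec c)) ` set cs = S \<union> (\<lambda>s. inv\<^bsub>G\<^esub> s) ` S"
    and u: "dec u = Some g" "g \<in> carrier G"
  shows "language G (automaton_of dec (membership_desc cs u)) \<noteq> {} \<longleftrightarrow> g \<in> generate G S"
proof -
  interpret group G by fact
  define V where "V = automaton_of dec (membership_desc cs u)"
  have H: "subgroup (generate G S) G"
    by (rule generate_is_subgroup) fact
  have labels: "m \<in> S \<union> (\<lambda>s. inv\<^bsub>G\<^esub> s) ` S \<longleftrightarrow> (\<exists>c\<in>set cs. dec c = Some m)" for m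
    unfolding cs(2)[symmetric] using cs(1) by force
  have trans0: "trans V 0 s = (if s = None then {(1, g)} else {})" for s
    using u(1) by (auto simp: V_def membership_desc_def)
  \<comment> \<open>Stated with \<open>Suc 0\<close>, the form into which simp rewrites
    \<open>1\<close>.\<close>
  have trans1: "trans V (Suc 0) s = (if s = None then {1} \<times> (S \<union> (\<lambda>s. inv\<^bsub>G\<^esub> s) ` S) else {})" for s
    unfolding set_eq_iff mem_Times_iff
    by (cases s) (auto simp: V_def membership_desc_def labels image_iff simp del: Un_iff)
  have label_in: "m \<in> generate G S" if "m \<in> S \<union> (\<lambda>s. inv\<^bsub>G\<^esub> s) ` S" for m
    using that by (auto intro: generate.incl generate.inv)
  \<comment> \<open>Membership is pulled back from the final content to the initial one: if
    \<open>x m\<close> and \<open>m\<close> lie in the subgroup, so does \<open>x\<close>. The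
    premise \<open>q = 1\<close> survives the induction because state 1 is never left.\<close>
  have sound: "x \<in> generate G S"
    if "run G V q x w r y" "q = 1" "x \<in> carrier G" "y \<in> generate G S" for q x w r y
    using that
  proof induction
    case (eps q' m q x w r y)
    then have m: "q' = 1" "m \<in> generate G S"
      using label_in by (auto simp: trans1)
    then have mc: "m \<in> carrier G"
      using H by (auto dest: subgroup.mem_carrier)
    have "x \<otimes>\<^bsub>G\<^esub> m \<in> generate G S"
      using eps m mc by simp
    then have "x \<otimes>\<^bsub>G\<^esub> m \<otimes>\<^bsub>G\<^esub> inv\<^bsub>G\<^esub> m \<in> generate G S"
      using H m by (simp add: subgroup.m_closed subgroup.m_inv_closed)
    then show ?case
      using eps.prems mc by (simp add: m_assoc)
  next
    case (read q' m q a x w r y)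
    then show ?case by (simp add: trans1)
  qed simp
  have step: "run G V 1 x [] 1 (x \<otimes>\<^bsub>G\<^esub> m)" if "m \<in> S \<union> (\<lambda>s. inv\<^bsub>G\<^esub> s) ` S" for x m
    by (rule run.eps[of 1 m]) (use that in \<open>simp_all add: trans1 run.stop\<close>)
  \<comment> \<open>A product is realised by concatenating two runs; \<open>x\<close> is arbitrary
    because the second starts from content \<open>x h1\<close>.\<close>
  have complete: "run G V 1 x [] 1 (x \<otimes>\<^bsub>G\<^esub> h)" if "h \<in> generate G S" "x \<in> carrier G" for x h
    using that
  proof (induction arbitrary: x)
    case one
    then show ?case by (simp add: run.stop)
  next
    case (eng h1 h2)
    then have "h1 \<in> carrier G" "h2 \<in> carrier G"
      using H by (auto dest: subgroup.mem_carrier)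
    then show ?case
      using run_append[OF eng.IH(1)[of x] eng.IH(2)[of "x \<otimes>\<^bsub>G\<^esub> h1"]] eng.prems
      by (simp add: m_assoc)
  qed (use step in auto)
  have V: "init V = 0" "accepting V = {1}" "alphabet V = {}"
    by (simp_all add: V_def membership_desc_def)
  \<comment> \<open>States 0 and 1 differ, so the run has a first move; it leaves \<open>g\<close>
    in the register, and \<open>sound\<close> applies with final content the identity.\<close>
  have "g \<in> generate G S" if "run G V 0 \<one>\<^bsub>G\<^esub> w 1 \<one>\<^bsub>G\<^esub>" for w
    using that
  proof cases
    case (eps q' m)
    then show ?thesis
      using u(2) by (auto simp: trans0 intro: sound generate.one)
  qed (auto simp: trans0)
  moreover have "run G V 0 \<one>\<^bsub>G\<^esub> [] 1 \<one>\<^bsub>G\<^esub>" if "g \<in> generate G S"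
  proof (rule run.eps[of 1 g])
    \<comment> \<open>The loops have to cancel \<open>g\<close>, hence contribute its
      inverse.\<close>
    have "inv\<^bsub>G\<^esub> g \<in> generate G S"
      using H that by (rule subgroup.m_inv_closed)
    from complete[OF this u(2)] show "run G V 1 (\<one>\<^bsub>G\<^esub> \<otimes>\<^bsub>G\<^esub> g) [] 1 \<one>\<^bsub>G\<^esub>"
      using u(2) by simp
  qed (simp add: trans0)
  ultimately show ?thesis
    unfolding V_def[symmetric] by (auto simp: language_def V)
qed

theorem theorem4:
  fixes G :: "('g, 'b) monoid_scheme"
    and H :: "'g set"
    and dec :: "nat list \<Rightarrow> 'g option"
  assumes "group G"
    and "subgroup H G" and "finitely_generated G H"
    and "group_encoding G dec"
    and "emptiness_decidable G dec"
  shows "membership_decidable G dec H"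
proof -
  interpret group G by fact
  obtain S where S: "finite S" "S \<subseteq> carrier G" "H = generate G S"
    using assms(3) by (auto simp: finitely_generated_def)
  have ran: "ran dec = carrier G"
    using assms(4) by (simp add: group_encoding_def)
  let ?T = "S \<union> (\<lambda>s. inv\<^bsub>G\<^esub> s) ` S"
  \<comment> \<open>Every element has a code, so finitely many codes cover the labels. Their mere
    existence suffices, since \<open>cs\<close> is fixed before \<open>u\<close> is given.\<close>
  have "?T \<subseteq> (\<lambda>c. the (dec c)) ` dom dec"
  proof
    fix m assume "m \<in> ?T"
    then have "m \<in> ran dec"
      using S(2) ran by auto
    then show "m \<in> (\<lambda>c. the (dec c)) ` dom dec"
      by (force simp: ran_def)
  qed
  then obtain C where C: "C \<subseteq> dom dec" "finite C" "?T = (\<lambda>c. the (dec c)) ` C"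
    using finite_subset_image[of ?T "\<lambda>c. the (dec c)" "dom dec"] S(1) by auto
  obtain cs where "set cs = C"
    using finite_list[OF \<open>finite C\<close>] by blast
  with C have cs: "set cs \<subseteq> dom dec" "(\<lambda>c. the (dec c)) ` set cs = ?T"
    by simp_all
  obtain h where h: "computable h" "\<And>u. desc_code (membership_desc cs u) = h (list_encode u)"
    using computable_membership_desc_code by blast
  have "language G (automaton_of dec (membership_desc cs u)) \<noteq> {} \<longleftrightarrow> the (dec u) \<in> H"
    if "u \<in> dom dec" for u
  proof -
    obtain g where g: "dec u = Some g"
      using \<open>u \<in> dom dec\<close> by blast
    with ran have "g \<in> carrier G"
      by (auto intro: ranI)
    from membership_desc_language[OF \<open>group G\<close> S(2) cs g this] g S(3) show ?thesis
      by simp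
  qed
  then show ?thesis
    unfolding membership_decidable_def
    using membership_desc_valid[OF ran cs(1)] h(2)
    by (intro decidable_problem_reduction[OF decidable_problem_not
            [OF assms(5)[unfolded emptiness_decidable_def]] h(1),
          where r = "membership_desc cs"]) auto
qed

end
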